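(* For all integers $n\ge k\ge 1$, $$\Big(\frac{d}{dx}\Big)^{k}H_{n,\lambda}^{Y}(x)=k!\sum_{j=0}^{n-k}\binom{n}{j}H_{j,\lambda}^{Y}(x)H_{\lambda}^{Y}(n-j,k),$$ and $$\frac{d}{dx}H_{n,\lambda}^{Y}(x)=\sum_{j=0}^{n-1}\binom{n}{j}E\big[\langle Y\rangle_{n-j,\lambda}\big]H_{j,\lambda}^{Y}(x).$$
   Context: Let $Y$ be a real random variable with $E[|Y|^{n}]<\infty$ for all integers $n\ge 0$ and $\lim_{n\to\infty}|t|^{n}E[|Y|^{n}]/n!=0$ for $|t|<r$, for some $r>0$. Fix a nonzero real $\lambda$. Put $\langle x\rangle_{0,\lambda}=1$, $\langle x\rangle_{n,\lambda}=x(x+\lambda)\cdots(x+(n-1)\lambda)$, and $e_\lambda^{-Y}(-t)=(1-\lambda t)^{-Y/\lambda}$, so $E[e_\lambda^{-Y}(-t)]=\sum_{n\ge0}E[\langle Y\rangle_{n,\lambda}]t^n/n!$ near $t=0$. The probabilistic heterogeneous Stirling numbers of the second kind are defined by $\frac{1}{k!}(E[e_{\lambda}^{-Y}(-t)]-1)^{k}=\sum_{n\ge k}H_{\lambda}^{Y}(n,k)t^{n}/n!$, and the probabilistic heterogeneous Bell polynomials by $e^{x(E[e_{\lambda}^{-Y}(-t)]-1)}=\sum_{n\ge0}H_{n,\lambda}^{Y}(x)t^{n}/n!$. *)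

theory Defs
  imports "HOL-Probability.Probability"
begin

(* <x>_{n,l} = x (x + l) ... (x + (n-1) l) *)
definition deg_rising :: "real \<Rightarrow> real \<Rightarrow> nat \<Rightarrow> real" where
  "deg_rising l x n = (\<Prod>i<n. x + of_nat i * l)"

(* e_l^x(t); as a real power it is meaningful where 1 + l t > 0, in particular near t = 0 *)
definition deg_exp :: "real \<Rightarrow> real \<Rightarrow> real \<Rightarrow> real" where
  "deg_exp l x t = (1 + l * t) powr (x / l)"

(* The function t |-> E[e_l^{-Y}(-t)], the integrand being (1 - l t)^{-Y/l}. *)
definition deg_mgf :: "'a measure \<Rightarrow> ('a \<Rightarrow> real) \<Rightarrow> real \<Rightarrow> real \<Rightarrow> real" where
  "deg_mgf M Y l t = prob_space.expectation M (\<lambda>\<omega>. deg_exp l (- Y \<omega>) (- t))"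

(* The number a_n determined by f(t) = (\<Sum>n. a_n t^n / n!) for t near 0. *)
definition egf_coeff :: "(real \<Rightarrow> real) \<Rightarrow> nat \<Rightarrow> real" where
  "egf_coeff f n = fact n * fps_nth (THE F. f has_fps_expansion F) n"

definition het_stirling :: "'a measure \<Rightarrow> ('a \<Rightarrow> real) \<Rightarrow> real \<Rightarrow> nat \<Rightarrow> nat \<Rightarrow> real" where
  "het_stirling M Y l n k = egf_coeff (\<lambda>t. 1 / fact k * (deg_mgf M Y l t - 1) ^ k) n"

definition het_bell :: "'a measure \<Rightarrow> ('a \<Rightarrow> real) \<Rightarrow> real \<Rightarrow> nat \<Rightarrow> real \<Rightarrow> real" where
  "het_bell M Y l n x = egf_coeff (\<lambda>t. exp (x * (deg_mgf M Y l t - 1))) n"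

end

theory Submission
  imports Defs "HOL-Complex_Analysis.Complex_Analysis"
begin

text \<open>
  Let A be the power series with coefficients E[<Y>_n] / n! for n > 0 and zero constant term, so that
  the Stirling numbers are the coefficients of A^k / k! and the Bell polynomials those of exp (x A).
  Differentiating exp (x A) in x multiplies it by A; comparing coefficients gives both identities.
  The analytic part is to show that A really converges to E[e_l^{-Y}(-t)] - 1 near 0. The binomial
  series of (1 - l t)^{-y/l} is dominated termwise by that of (1 - |l| s)^{-|y|/|l|} = exp (u |y|),
  where 1 - |l| s = exp (- |l| u), and exp (u |Y|) is integrable for u < r.
\<close>

section \<open>Real power series expansions\<close>

text \<open>Induction on \<open>n\<close> with \<open>f\<close> generalized: the expansion of
  \<open>deriv f\<close> is the formal derivative of \<open>F\<close>, whose coefficient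
  \<open>n\<close> is \<open>Suc n\<close> times coefficient \<open>Suc n\<close> of
  \<open>F\<close>. Hence the function determines its coefficients.\<close>

lemma fps_nth_fps_expansion_real:
  fixes f :: "real \<Rightarrow> real"
  assumes "f has_fps_expansion F"
  shows "fps_nth F n = (deriv ^^ n) f 0 / fact n"
  using assms
proof (induction n arbitrary: f F)
  case 0
  then have "eval_fps F 0 = f 0"
    by (auto simp: has_fps_expansion_def dest: eventually_nhds_x_imp_x)
  then show ?case
    by (simp add: eval_fps_at_0)
next
  case (Suc n)
  have "real (Suc n) * fps_nth F (Suc n) = (deriv ^^ Suc n) f 0 / fact n"
    using Suc.IH[OF has_fps_expansion_deriv[OF Suc.prems]] by (simp add: funpow_swap1)
  then show ?case
    by (simp add: fact_Suc field_simps del: of_nat_Suc)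
qed

lemma has_fps_expansion_unique_real:
  fixes f :: "real \<Rightarrow> real"
  assumes "f has_fps_expansion F" "f has_fps_expansion G"
  shows "F = G"
  using assms by (simp add: fps_eq_iff fps_nth_fps_expansion_real)

text \<open>This resolves the definite description in \<open>egf_coeff\<close>: by uniqueness, any
  expansion that can be exhibited is the one described.\<close>

lemma egf_coeff_eq:
  assumes "f has_fps_expansion F"
  shows "egf_coeff f n = fact n * fps_nth F n"
proof -
  have "(THE F. f has_fps_expansion F) = F"
    using assms has_fps_expansion_unique_real by blast
  then show ?thesis by (simp add: egf_coeff_def)
qed

text \<open>Coefficientwise embedding that carries real series to the complex setting, where
  \<open>has_fps_expansion_compose\<close> gives the convergence of a composition.\<close>

definition fps_complex_of_real :: "real fps \<Rightarrow> complex fps" where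
  "fps_complex_of_real F = Abs_fps (\<lambda>n. complex_of_real (fps_nth F n))"

lemma fps_nth_complex_of_real [simp]:
  "fps_nth (fps_complex_of_real F) n = complex_of_real (fps_nth F n)"
  by (simp add: fps_complex_of_real_def)

lemma fps_complex_of_real_mult:
  "fps_complex_of_real (F * G) = fps_complex_of_real F * fps_complex_of_real G"
  by (simp add: fps_eq_iff fps_mult_nth)

lemma fps_complex_of_real_power:
  "fps_complex_of_real (F ^ n) = fps_complex_of_real F ^ n"
proof (induction n)
  case 0
  show ?case by (simp add: fps_eq_iff)
qed (simp add: fps_complex_of_real_mult)

lemma fps_complex_of_real_compose:
  "fps_complex_of_real (F oo G) = fps_complex_of_real F oo fps_complex_of_real G"
  by (simp add: fps_eq_iff fps_compose_nth flip: fps_complex_of_real_power)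

lemma fps_conv_radius_complex_of_real [simp]:
  "fps_conv_radius (fps_complex_of_real F) = fps_conv_radius F"
  by (simp add: fps_conv_radius_def conv_radius_def)

lemma eval_fps_complex_of_real:
  assumes "ereal \<bar>t\<bar> < fps_conv_radius F"
  shows "eval_fps (fps_complex_of_real F) (complex_of_real t) = complex_of_real (eval_fps F t)"
proof -
  have "summable (\<lambda>n. fps_nth F n * t ^ n)"
    using assms by (intro summable_fps) auto
  then have "(\<lambda>n. complex_of_real (fps_nth F n * t ^ n)) sums complex_of_real (eval_fps F t)"
    unfolding eval_fps_def by (intro sums_of_real summable_sums)
  then show ?thesis
    by (simp add: eval_fps_def sums_iff)
qed

lemma eventually_abs_less_fps_conv_radius:
  fixes F :: "real fps"
  assumes "fps_conv_radius F > 0"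
  shows "eventually (\<lambda>t. ereal \<bar>t\<bar> < fps_conv_radius F) (nhds 0)"
proof -
  have "eventually (\<lambda>t. t \<in> eball 0 (fps_conv_radius F)) (nhds (0::real))"
    using assms by (intro eventually_nhds_in_open) (auto simp: zero_ereal_def)
  then show ?thesis
    by eventually_elim (auto simp: in_eball_iff)
qed

text \<open>The complexified series compose to a series with positive radius, and the embedding
  preserves both composition and radius. Restricting the resulting identity of complex evaluations
  to the real axis gives the real one.\<close>

lemma has_fps_expansion_compose_real:
  fixes f g :: "real \<Rightarrow> real"
  assumes F: "f has_fps_expansion F" and G: "g has_fps_expansion G" "fps_nth G 0 = 0"
  shows "(\<lambda>t. f (g t)) has_fps_expansion (F oo G)"
proof -
  let ?F = "fps_complex_of_real F" and ?G = "fps_complex_of_real G"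
  have rad: "fps_conv_radius F > 0" "fps_conv_radius G > 0"
    using F G by (auto simp: has_fps_expansion_def)
  have "(eval_fps ?F \<circ> eval_fps ?G) has_fps_expansion (?F oo ?G)"
    using rad G by (intro has_fps_expansion_compose eval_fps_has_fps_expansion) auto
  then have H: "fps_conv_radius (F oo G) > 0"
    and ev: "eventually (\<lambda>z. eval_fps (fps_complex_of_real (F oo G)) z = eval_fps ?F (eval_fps ?G z))
               (nhds 0)"
    by (auto simp: has_fps_expansion_def simp flip: fps_complex_of_real_compose)
  have lim: "filterlim complex_of_real (nhds 0) (nhds 0)"
    using tendsto_of_real[OF filterlim_ident[of "nhds (0::real)"], where 'a = complex] by simp
  have "g 0 = 0"
    using fps_nth_fps_expansion_real[OF G(1), of 0] G(2) by simp
  moreover have "isCont g 0"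
    using has_fps_expansion_imp_continuous[OF G(1), of UNIV] by simp
  ultimately have g: "filterlim g (nhds 0) (nhds 0)"
    by (simp add: isCont_def tendsto_nhds_iff)
  have evg: "eventually (\<lambda>t. eval_fps G t = g t) (nhds 0)"
    using G by (simp add: has_fps_expansion_def)
  have "eventually (\<lambda>t. eval_fps F t = f t) (nhds 0)"
    using F by (simp add: has_fps_expansion_def)
  then have evf: "eventually (\<lambda>t. eval_fps F (g t) = f (g t)) (nhds 0)"
    using g by (rule eventually_compose_filterlim)
  \<comment> \<open>For \<open>t\<close> near 0, \<open>t\<close> lies within the radii of
    \<open>F oo G\<close> and \<open>G\<close>, and \<open>g t\<close> within that of
    \<open>F\<close>, because \<open>g\<close> tends to 0. So all three complex evaluations are
    embedded real ones, and injectivity of the embedding finishes.\<close>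
  have "eventually (\<lambda>t. eval_fps (F oo G) t = f (g t)) (nhds 0)"
    using eventually_compose_filterlim[OF ev lim] evf evg
      eventually_abs_less_fps_conv_radius[OF H] eventually_abs_less_fps_conv_radius[OF rad(2)]
      eventually_compose_filterlim[OF eventually_abs_less_fps_conv_radius[OF rad(1)] g]
  proof eventually_elim
    case (elim t)
    then have "complex_of_real (eval_fps (F oo G) t) = complex_of_real (f (g t))"
      by (simp add: eval_fps_complex_of_real)
    then show ?case by (simp only: of_real_eq_iff)
  qed
  with H show ?thesis
    by (simp add: has_fps_expansion_def)
qed

section \<open>Differentiating the exponential of a power series in its parameter\<close>

text \<open>Since \<open>A ^ i\<close> has no terms below order \<open>i\<close>, each coefficient
  of \<open>fps_exp x oo A\<close> is a polynomial in \<open>x\<close> and can be differentiated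
  term by term.\<close>

lemma has_real_derivative_fps_exp_compose_nth:
  fixes A :: "real fps"
  assumes "fps_nth A 0 = 0"
  shows "((\<lambda>x. fps_nth (fps_exp x oo A) n) has_real_derivative
           fps_nth ((fps_exp x oo A) * A) n) (at x)"
proof -
  \<comment> \<open>The cutoff \<open>N\<close> is free so that one truncation serves all
    coefficients up to \<open>N\<close> at once.\<close>
  have exp_nth: "fps_nth (fps_exp y oo A) m = (\<Sum>i\<le>N. y ^ i / fact i * fps_nth (A ^ i) m)"
    if "m \<le> N" for y m N
    unfolding fps_compose_nth using that startsby_zero_power_prefix[OF assms]
    by (intro sum.mono_neutral_cong_left) auto
  have "fps_nth ((fps_exp x oo A) * A) n =
      (\<Sum>j=0..n. (\<Sum>i\<le>n. x ^ i / fact i * fps_nth (A ^ i) j) * fps_nth A (n - j))"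
    unfolding fps_mult_nth by (intro sum.cong refl) (simp add: exp_nth[of _ n])
  also have "\<dots> = (\<Sum>i\<le>n. x ^ i / fact i * fps_nth (A ^ i * A) n)"
    unfolding fps_mult_nth sum_distrib_left sum_distrib_right
    by (subst sum.swap) (simp add: mult_ac)
  also have "\<dots> = (\<Sum>i\<le>n. x ^ i / fact i * fps_nth (A ^ Suc i) n)"
    by (simp add: mult.commute)
  finally have eq: "fps_nth ((fps_exp x oo A) * A) n = \<dots>" .
  \<comment> \<open>The extra summand at \<open>Suc n\<close> vanishes, but including it makes the
    differentiated sum, after the index shift, end exactly at \<open>n\<close>.\<close>
  have "((\<lambda>y. \<Sum>i\<le>Suc n. y ^ i / fact i * fps_nth (A ^ i) n) has_real_derivative
      (\<Sum>i\<le>Suc n. real i * x ^ (i - 1) / fact i * fps_nth (A ^ i) n)) (at x)"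
    by (intro DERIV_sum) (auto intro!: derivative_eq_intros)
  also have "(\<Sum>i\<le>Suc n. real i * x ^ (i - 1) / fact i * fps_nth (A ^ i) n) =
      (\<Sum>i\<le>n. x ^ i / fact i * fps_nth (A ^ Suc i) n)"
    by (subst sum.atMost_Suc_shift) (simp add: fact_Suc del: power_Suc of_nat_Suc)
  finally show ?thesis
    unfolding eq by (simp add: exp_nth[of n "Suc n"] del: sum.atMost_Suc)
qed

text \<open>The factor \<open>B\<close> does not depend on \<open>x\<close>; taking \<open>B\<close>
  to be \<open>A ^ k\<close> gives the induction step for higher derivatives.\<close>

lemma has_real_derivative_fps_exp_compose_mult_nth:
  fixes A B :: "real fps"
  assumes "fps_nth A 0 = 0"
  shows "((\<lambda>x. fps_nth ((fps_exp x oo A) * B) n) has_real_derivative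
           fps_nth ((fps_exp x oo A) * (A * B)) n) (at x)"
proof -
  have "((\<lambda>x. fps_nth ((fps_exp x oo A) * B) n) has_real_derivative
           fps_nth (((fps_exp x oo A) * A) * B) n) (at x)"
    unfolding fps_mult_nth[of _ B]
    by (intro DERIV_sum DERIV_cmult_right has_real_derivative_fps_exp_compose_nth assms)
  then show ?thesis by (simp add: mult.assoc)
qed

lemma higher_deriv_fps_exp_compose_nth:
  fixes A :: "real fps"
  assumes "fps_nth A 0 = 0"
  shows "(deriv ^^ k) (\<lambda>x. c * fps_nth (fps_exp x oo A) n) =
           (\<lambda>x. c * fps_nth ((fps_exp x oo A) * A ^ k) n)"
proof (induction k)
  case (Suc k)
  have "deriv (\<lambda>x. c * fps_nth ((fps_exp x oo A) * A ^ k) n) x =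
      c * fps_nth ((fps_exp x oo A) * A ^ Suc k) n" for x
    using DERIV_cmult[OF has_real_derivative_fps_exp_compose_mult_nth[OF assms, of "A ^ k" n x]]
    by (intro DERIV_imp_deriv) simp
  with Suc show ?case by simp
qed simp

section \<open>The expansion of the expected degenerate exponential\<close>

text \<open>This is the binomial series with exponent \<open>- y / l\<close> at
  \<open>- (l * t)\<close>. Factoring \<open>l\<close> out of each factor of
  \<open>deg_rising\<close> leaves a Pochhammer symbol, and the two alternating signs
  cancel.\<close>

lemma deg_rising_sums:
  assumes "l \<noteq> 0" "\<bar>l * t\<bar> < 1"
  shows "(\<lambda>n. deg_rising l y n / fact n * t ^ n) sums deg_exp l (- y) (- t)"
proof -
  have "deg_rising l y n = pochhammer (y / l) n * l ^ n" for n
  proof -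
    have "deg_rising l y n = (\<Prod>i<n. (y / l + real i) * l)"
      unfolding deg_rising_def using assms(1) by (intro prod.cong) (auto simp: field_simps)
    then show ?thesis
      by (simp add: prod.distrib pochhammer_prod atLeast0LessThan)
  qed
  then have "(- y / l gchoose n) * (- (l * t)) ^ n = deg_rising l y n / fact n * t ^ n" for n
    by (simp add: gbinomial_pochhammer power_minus[of "l * t"] power_mult_distrib)
  moreover have "(\<lambda>n. (- y / l gchoose n) * (- (l * t)) ^ n) sums (1 + - (l * t)) powr (- y / l)"
    using assms by (intro gen_binomial_real) auto
  ultimately show ?thesis
    by (simp add: deg_exp_def)
qed

lemma abs_deg_rising_le: "\<bar>deg_rising l y n\<bar> \<le> deg_rising \<bar>l\<bar> \<bar>y\<bar> n"
  unfolding deg_rising_def abs_prod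
  by (intro prod_mono) (auto intro: order.trans[OF abs_triangle_ineq] simp: abs_mult)

text \<open>The sequence tending to 0 is bounded by some \<open>B\<close>, so the expected terms of
  the exponential series at \<open>u\<close> are dominated by the geometric series
  \<open>B * (u / t) ^ m\<close>. Summation and integration may then be interchanged.\<close>

lemma integrable_exp_abs:
  fixes Y :: "'a \<Rightarrow> real"
  assumes int: "\<And>m::nat. integrable M (\<lambda>\<omega>. \<bar>Y \<omega>\<bar> ^ m)"
    and lim: "(\<lambda>m. t ^ m * (\<integral>\<omega>. \<bar>Y \<omega>\<bar> ^ m \<partial>M) / fact m) \<longlonglongrightarrow> 0"
    and u: "0 \<le> u" "u < t"
  shows "integrable M (\<lambda>\<omega>. exp (u * \<bar>Y \<omega>\<bar>))"
proof -
  let ?E = "\<lambda>m. \<integral>\<omega>. \<bar>Y \<omega>\<bar> ^ m \<partial>M"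
  obtain B where B: "\<And>m. \<bar>t ^ m * ?E m / fact m\<bar> \<le> B"
    using convergent_imp_Bseq[OF convergentI[OF lim]] by (auto simp: Bseq_def)
  have exp_series: "(\<lambda>m. u ^ m / fact m * \<bar>y\<bar> ^ m) sums exp (u * \<bar>y\<bar>)" for y
    using exp_converges[of "u * \<bar>y\<bar>"] by (simp add: power_mult_distrib field_simps)
  have "integrable M (\<lambda>\<omega>. \<Sum>m. u ^ m / fact m * \<bar>Y \<omega>\<bar> ^ m)"
  proof (rule integrable_suminf)
    show "integrable M (\<lambda>\<omega>. u ^ m / fact m * \<bar>Y \<omega>\<bar> ^ m)" for m
      using int by simp
    show "AE \<omega> in M. summable (\<lambda>m. norm (u ^ m / fact m * \<bar>Y \<omega>\<bar> ^ m))"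
      using sums_summable[OF exp_series] u by (simp add: abs_mult power_abs)
    have bound: "norm (u ^ m / fact m * ?E m) \<le> B * (u / t) ^ m" for m
    proof -
      have "norm (u ^ m / fact m * ?E m) = \<bar>t ^ m * ?E m / fact m\<bar> * (u / t) ^ m"
        using u by (simp add: abs_mult power_divide field_simps)
      also have "\<dots> \<le> B * (u / t) ^ m"
        using u by (intro mult_right_mono B) auto
      finally show ?thesis .
    qed
    have "summable (\<lambda>m. B * (u / t) ^ m)"
      using u by (intro summable_mult summable_geometric) auto
    then have "summable (\<lambda>m. u ^ m / fact m * ?E m)"
      by (rule summable_comparison_test'[where N = 0]) (rule bound)
    then show "summable (\<lambda>m. \<integral>\<omega>. norm (u ^ m / fact m * \<bar>Y \<omega>\<bar> ^ m) \<partial>M)"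
      using u by (simp add: abs_mult power_abs)
  qed
  then show ?thesis
    using exp_series by (simp add: sums_iff)
qed

text \<open>At the radius \<open>s\<close> the absolute partial sums are bounded by an integrable
  function, which justifies exchanging sum and expectation for all \<open>t\<close> with absolute
  value below \<open>s\<close>.\<close>

lemma deg_mgf_has_fps_expansion:
  fixes Y :: "'a \<Rightarrow> real"
  assumes meas: "Y \<in> borel_measurable M"
    and int: "integrable M (\<lambda>\<omega>. exp (u * \<bar>Y \<omega>\<bar>))"
    and "u > 0" "l \<noteq> 0"
  shows "deg_mgf M Y l has_fps_expansion
           Abs_fps (\<lambda>n. (\<integral>\<omega>. deg_rising l (Y \<omega>) n \<partial>M) / fact n)"
proof -
  \<comment> \<open>Chosen so that the dominating binomial series at \<open>s\<close> sums to
    exactly \<open>exp (u * \<bar>y\<bar>)\<close>; also \<open>\<bar>l\<bar> * s < 1\<close>, so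
    that series converges.\<close>
  define s where "s = (1 - exp (- \<bar>l\<bar> * u)) / \<bar>l\<bar>"
  have ls: "\<bar>l\<bar> * s = 1 - exp (- \<bar>l\<bar> * u)"
    using \<open>l \<noteq> 0\<close> by (simp add: s_def)
  have "s > 0"
    using assms by (simp add: s_def)
  have "deg_exp \<bar>l\<bar> (- \<bar>y\<bar>) (- s) = exp (u * \<bar>y\<bar>)" for y
    using \<open>l \<noteq> 0\<close> by (simp add: deg_exp_def ls powr_def)
  moreover have "\<bar>\<bar>l\<bar> * s\<bar> < 1"
    using assms by (simp add: ls)
  ultimately have dom:
    "(\<lambda>n. deg_rising \<bar>l\<bar> \<bar>y\<bar> n / fact n * s ^ n) sums exp (u * \<bar>y\<bar>)" for y
    using deg_rising_sums[of "\<bar>l\<bar>" s "\<bar>y\<bar>"] \<open>l \<noteq> 0\<close> by simp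
  have nonneg: "0 \<le> deg_rising \<bar>l\<bar> \<bar>y\<bar> n" for y n
    by (rule order.trans[OF abs_ge_zero abs_deg_rising_le])
  \<comment> \<open>Singletons will bound single terms, and initial segments the partial
    sums.\<close>
  have partial: "(\<Sum>n\<in>N. \<bar>deg_rising l y n / fact n * s ^ n\<bar>) \<le> exp (u * \<bar>y\<bar>)"
    if "finite N" for y N
  proof -
    have "(\<Sum>n\<in>N. \<bar>deg_rising l y n / fact n * s ^ n\<bar>) \<le>
        (\<Sum>n\<in>N. deg_rising \<bar>l\<bar> \<bar>y\<bar> n / fact n * s ^ n)"
      using \<open>s > 0\<close>
      by (intro sum_mono) (auto simp: abs_mult intro!: mult_right_mono divide_right_mono abs_deg_rising_le)
    also have "\<dots> \<le> (\<Sum>n. deg_rising \<bar>l\<bar> \<bar>y\<bar> n / fact n * s ^ n)"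
      using nonneg \<open>s > 0\<close> that by (intro sum_le_suminf sums_summable[OF dom]) auto
    also have "\<dots> = exp (u * \<bar>y\<bar>)"
      by (rule sums_unique[OF dom, symmetric])
    finally show ?thesis .
  qed
  have [measurable]: "(\<lambda>\<omega>. deg_rising l (Y \<omega>) n) \<in> borel_measurable M" for n
    using meas unfolding deg_rising_def by measurable
  have int_s: "integrable M (\<lambda>\<omega>. deg_rising l (Y \<omega>) n / fact n * s ^ n)" for n
    using partial[of "{n}"] by (intro Bochner_Integration.integrable_bound[OF int]) auto
  have int_rising: "integrable M (\<lambda>\<omega>. deg_rising l (Y \<omega>) n)" for n
    using integrable_mult_left[OF int_s[of n], of "fact n / s ^ n"] \<open>s > 0\<close> by simp
  \<comment> \<open>The terms are nonnegative, and integrating \<open>partial\<close> bounds every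
    partial sum by the expectation of \<open>exp (u * \<bar>Y \<omega>\<bar>)\<close>.\<close>
  have summable_s: "summable (\<lambda>n. \<integral>\<omega>. \<bar>deg_rising l (Y \<omega>) n / fact n * s ^ n\<bar> \<partial>M)"
  proof (rule summableI_nonneg_bounded)
    show "(\<Sum>n<N. \<integral>\<omega>. \<bar>deg_rising l (Y \<omega>) n / fact n * s ^ n\<bar> \<partial>M) \<le>
        (\<integral>\<omega>. exp (u * \<bar>Y \<omega>\<bar>) \<partial>M)" for N
    proof (subst Bochner_Integration.integral_sum[symmetric])
      show "(\<integral>\<omega>. (\<Sum>n<N. \<bar>deg_rising l (Y \<omega>) n / fact n * s ^ n\<bar>) \<partial>M) \<le>
          (\<integral>\<omega>. exp (u * \<bar>Y \<omega>\<bar>) \<partial>M)"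
        by (intro integral_mono int partial Bochner_Integration.integrable_sum integrable_abs int_s) auto
    qed (intro integrable_abs int_s)
  qed auto
  show ?thesis
  proof (rule has_fps_expansionI)
    have "eventually (\<lambda>t. t \<in> {-s<..<s}) (nhds 0)"
      using \<open>s > 0\<close> by (intro eventually_nhds_in_open) auto
    then show "eventually (\<lambda>t. (\<lambda>n. fps_nth (Abs_fps (\<lambda>n. (\<integral>\<omega>. deg_rising l (Y \<omega>) n \<partial>M) / fact n)) n * t ^ n)
        sums deg_mgf M Y l t) (nhds 0)"
    proof eventually_elim
      case (elim t)
      then have t: "\<bar>t\<bar> \<le> s" by auto
      have le: "\<bar>deg_rising l y n / fact n * t ^ n\<bar> \<le> \<bar>deg_rising l y n / fact n * s ^ n\<bar>" for y n
        using t \<open>s > 0\<close> by (auto simp: abs_mult power_abs intro!: divide_right_mono mult_left_mono power_mono)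
      have "\<bar>l * t\<bar> \<le> \<bar>l\<bar> * s"
        using t by (simp add: abs_mult mult_left_mono)
      then have "\<bar>l * t\<bar> < 1"
        by (simp add: ls order.strict_trans1)
      then have "deg_exp l (- y) (- t) = (\<Sum>n. deg_rising l y n / fact n * t ^ n)" for y
        using deg_rising_sums[OF \<open>l \<noteq> 0\<close>] by (simp add: sums_iff)
      then have mgf: "deg_mgf M Y l t = (\<integral>\<omega>. (\<Sum>n. deg_rising l (Y \<omega>) n / fact n * t ^ n) \<partial>M)"
        by (simp add: deg_mgf_def)
      have "(\<lambda>n. \<integral>\<omega>. deg_rising l (Y \<omega>) n / fact n * t ^ n \<partial>M) sums deg_mgf M Y l t"
        unfolding mgf
      proof (rule sums_integral)
        show "integrable M (\<lambda>\<omega>. deg_rising l (Y \<omega>) n / fact n * t ^ n)" for n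
          using int_rising by simp
        have "summable (\<lambda>n. \<bar>deg_rising l y n / fact n * s ^ n\<bar>)" for y
          using partial by (intro summableI_nonneg_bounded) auto
        then have "summable (\<lambda>n. norm (deg_rising l y n / fact n * t ^ n))" for y
          by (rule summable_comparison_test'[where N = 0]) (use le in simp)
        then show "AE \<omega> in M. summable (\<lambda>n. norm (deg_rising l (Y \<omega>) n / fact n * t ^ n))"
          by simp
        show "summable (\<lambda>n. \<integral>\<omega>. norm (deg_rising l (Y \<omega>) n / fact n * t ^ n) \<partial>M)"
        proof (rule summable_comparison_test'[OF summable_s, where N = 0])
          show "norm (\<integral>\<omega>. norm (deg_rising l (Y \<omega>) n / fact n * t ^ n) \<partial>M) \<le>
              (\<integral>\<omega>. \<bar>deg_rising l (Y \<omega>) n / fact n * s ^ n\<bar> \<partial>M)" for n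
          proof -
            have "(\<integral>\<omega>. norm (deg_rising l (Y \<omega>) n / fact n * t ^ n) \<partial>M) \<le>
                (\<integral>\<omega>. \<bar>deg_rising l (Y \<omega>) n / fact n * s ^ n\<bar> \<partial>M)"
              using le int_rising by (intro integral_mono) auto
            then show ?thesis by simp
          qed
        qed
      qed
      then show ?case by simp
    qed
  qed
qed

section \<open>The two derivative formulas by comparison of coefficients\<close>

theorem theorem2p14:
  fixes M :: "'a measure" and Y :: "'a \<Rightarrow> real" and l r x :: real and n k :: nat
  assumes "prob_space M"
    and "Y \<in> borel_measurable M"
    and "\<And>m::nat. integrable M (\<lambda>\<omega>. \<bar>Y \<omega>\<bar> ^ m)"
    and "r > 0"
    and "\<And>t::real. \<bar>t\<bar> < r \<Longrightarrow>
           (\<lambda>m. \<bar>t\<bar> ^ m * prob_space.expectation M (\<lambda>\<omega>. \<bar>Y \<omega>\<bar> ^ m) / fact m) \<longlonglongrightarrow> 0"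
    and "l \<noteq> 0"
    and "1 \<le> k" and "k \<le> n"
  shows "(deriv ^^ k) (\<lambda>x. het_bell M Y l n x) x =
           fact k * (\<Sum>j=0..n-k. of_nat (n choose j) * het_bell M Y l j x * het_stirling M Y l (n - j) k)
       \<and> ((\<lambda>x. het_bell M Y l n x) has_real_derivative
           (\<Sum>j=0..n-1. of_nat (n choose j) *
              prob_space.expectation M (\<lambda>\<omega>. deg_rising l (Y \<omega>) (n - j)) * het_bell M Y l j x)) (at x)"
proof -
  define A where "A = Abs_fps (\<lambda>n. (\<integral>\<omega>. deg_rising l (Y \<omega>) n \<partial>M) / fact n) - 1"
  \<comment> \<open>The moment condition is applied at \<open>r / 2\<close>, inside the allowed
    range; exponential integrability needs a strictly smaller positive parameter, here
    \<open>r / 3\<close>.\<close>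
  have "integrable M (\<lambda>\<omega>. exp (r / 3 * \<bar>Y \<omega>\<bar>))"
    using assms(4) assms(5)[of "r / 2"] by (intro integrable_exp_abs[OF assms(3), of "r / 2"]) auto
  then have A: "(\<lambda>t. deg_mgf M Y l t - 1) has_fps_expansion A"
    unfolding A_def using assms
    by (intro has_fps_expansion_diff has_fps_expansion_1 deg_mgf_has_fps_expansion[of _ _ "r / 3"]) auto
  \<comment> \<open>The empty product is 1 and the total mass is 1, so subtracting 1 removes the
    constant term.\<close>
  have A0: "fps_nth A 0 = 0"
    using prob_space.prob_space[OF assms(1)] by (simp add: A_def deg_rising_def)
  have A_nth: "fps_nth A m = (\<integral>\<omega>. deg_rising l (Y \<omega>) m \<partial>M) / fact m" if "m > 0" for m
    using that by (simp add: A_def)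
  have bell: "het_bell M Y l m y = fact m * fps_nth (fps_exp y oo A) m" for m y
    unfolding het_bell_def
    by (intro egf_coeff_eq has_fps_expansion_compose_real[OF has_fps_expansion_exp] A A0)
  have stirling: "fact k * het_stirling M Y l m k = fact m * fps_nth (A ^ k) m" for m
  proof -
    have "het_stirling M Y l m k = fact m * fps_nth (fps_const (1 / fact k) * A ^ k) m"
      unfolding het_stirling_def
      by (intro egf_coeff_eq has_fps_expansion_cmult_left has_fps_expansion_power A)
    then show ?thesis by simp
  qed
  \<comment> \<open>The Cauchy product stops at \<open>n - i\<close> because \<open>A ^ i\<close>
    vanishes below order \<open>i\<close>. The case \<open>i = k\<close> gives the first identity
    and \<open>i = 1\<close> the second.\<close>
  have coeff: "fact n * fps_nth ((fps_exp x oo A) * A ^ i) n =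
      (\<Sum>j=0..n-i. real (n choose j) * het_bell M Y l j x * (fact (n - j) * fps_nth (A ^ i) (n - j)))"
    if "i \<le> n" for i
  proof -
    have "fact n * fps_nth ((fps_exp x oo A) * A ^ i) n =
        (\<Sum>j=0..n. fact n * (fps_nth (fps_exp x oo A) j * fps_nth (A ^ i) (n - j)))"
      by (simp add: fps_mult_nth sum_distrib_left)
    also have "\<dots> = (\<Sum>j=0..n-i. fact n * (fps_nth (fps_exp x oo A) j * fps_nth (A ^ i) (n - j)))"
      using startsby_zero_power_prefix[OF A0, of i] that by (intro sum.mono_neutral_right) auto
    also have "\<dots> = (\<Sum>j=0..n-i. real (n choose j) * het_bell M Y l j x *
        (fact (n - j) * fps_nth (A ^ i) (n - j)))"
      using that by (intro sum.cong refl) (auto simp: bell binomial_fact)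
    finally show ?thesis .
  qed
  have "(deriv ^^ k) (\<lambda>x. het_bell M Y l n x) x = fact n * fps_nth ((fps_exp x oo A) * A ^ k) n"
    by (simp add: bell higher_deriv_fps_exp_compose_nth[OF A0])
  also have "\<dots> = fact k * (\<Sum>j=0..n-k. real (n choose j) * het_bell M Y l j x * het_stirling M Y l (n - j) k)"
    unfolding coeff[OF assms(8)] sum_distrib_left
    by (intro sum.cong refl) (simp flip: stirling)
  finally have first: "(deriv ^^ k) (\<lambda>x. het_bell M Y l n x) x = \<dots>" .
  have "((\<lambda>x. het_bell M Y l n x) has_real_derivative fact n * fps_nth ((fps_exp x oo A) * A ^ 1) n) (at x)"
    using has_real_derivative_fps_exp_compose_nth[OF A0] by (simp add: bell DERIV_cmult)
  also have "fact n * fps_nth ((fps_exp x oo A) * A ^ 1) n =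
      (\<Sum>j=0..n-1. of_nat (n choose j) *
              prob_space.expectation M (\<lambda>\<omega>. deg_rising l (Y \<omega>) (n - j)) * het_bell M Y l j x)"
    \<comment> \<open>From \<open>1 \<le> k\<close> and \<open>k \<le> n\<close> follows
      \<open>1 \<le> n\<close>, so \<open>n - j\<close> is positive for every \<open>j\<close> up to
      \<open>n - 1\<close> and the coefficient of \<open>A\<close> there is the expectation itself,
      untouched by the subtracted 1.\<close>
    using assms(7,8) by (subst coeff) (auto intro!: sum.cong simp: A_nth)
  finally show ?thesis
    using first by blast
qed

end
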